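(* There exists an ideal $\mathcal{I}$ on an infinite countable set $X$ such that: (1) $\mathcal{I}$ is a $\mathbf{\Sigma^0_6}$ subset of $\mathcal{P}(X)$; (2) there is no $P^+$-ideal $\mathcal{J}$ on $X$ with $\mathcal{I}\subseteq\mathcal{J}$; (3) $\mathrm{conv}\not\leq_K\mathcal{I}$.
   Context: An ideal on an infinite countable set $X$ is a family $\mathcal{I}\subseteq\mathcal{P}(X)$ closed under subsets and finite unions, containing all finite subsets of $X$, and with $\mathcal{I}\neq\mathcal{P}(X)$ (so $X=\bigcup\mathcal{I}$). The power set $\mathcal{P}(X)$ is identified with $2^X$ (product topology, $2=\{0,1\}$ discrete) via characteristic functions, and descriptive complexity of ideals on $X$ (e.g. being $\mathbf{\Sigma^0_6}$) refers to this topology. An ideal $\mathcal{J}$ on $X$ is a $P^+$-ideal if for every decreasing sequence $(A_n)_{n\in\omega}$ ($A_{n+1}\subseteq A_n$) of subsets of $X$ not belonging to $\mathcal{J}$ there is $B\subseteq X$ with $B\notin\mathcal{J}$ such that $B\setminus A_n$ is finite for all $n\in\omega$. Katětov preorder: for ideals $\mathcal{I},\mathcal{J}$, $\mathcal{I}\leq_K\mathcal{J}$ means there is a function $f:\bigcup\mathcal{J}\to\bigcup\mathcal{I}$ such that $f^{-1}[A]\in\mathcal{J}$ for each $A\in\mathcal{I}$. $\mathrm{conv}$ is the ideal on $\mathbb{Q}\cap[0,1]$ consisting of all sets $A\subseteq\mathbb{Q}\cap[0,1]$ that can be covered by (the sets of terms of) finitely many sequences in $\mathbb{Q}\cap[0,1]$,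 each convergent in $[0,1]$. *)

theory Defs
  imports "HOL-Analysis.Analysis"
begin

definition ideal_on :: "'a set \<Rightarrow> 'a set set \<Rightarrow> bool" where
  "ideal_on X I \<longleftrightarrow>
     I \<subseteq> Pow X \<and>
     (\<forall>A\<in>I. \<forall>B. B \<subseteq> A \<longrightarrow> B \<in> I) \<and>
     (\<forall>A\<in>I. \<forall>B\<in>I. A \<union> B \<in> I) \<and>
     (\<forall>F. F \<subseteq> X \<and> finite F \<longrightarrow> F \<in> I) \<and>
     I \<noteq> Pow X"

definition P_plus_ideal :: "'a set \<Rightarrow> 'a set set \<Rightarrow> bool" where
  "P_plus_ideal X J \<longleftrightarrow>
     ideal_on X J \<and>
     (\<forall>A :: nat \<Rightarrow> 'a set.
        (\<forall>n. A n \<subseteq> X \<and> A n \<notin> J \<and> A (Suc n) \<subseteq> A n) \<longrightarrow>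
        (\<exists>B. B \<subseteq> X \<and> B \<notin> J \<and> (\<forall>n. finite (B - A n))))"

definition katetov_le :: "'a set set \<Rightarrow> 'b set set \<Rightarrow> bool"  (infix "\<le>\<^sub>K" 50) where
  "I \<le>\<^sub>K J \<longleftrightarrow>
     (\<exists>f. f \<in> \<Union>J \<rightarrow> \<Union>I \<and> (\<forall>A\<in>I. f -` A \<inter> \<Union>J \<in> J))"

definition conv :: "real set set" where
  "conv = {A. A \<subseteq> \<rat> \<inter> {0..1} \<and>
     (\<exists>S :: (nat \<Rightarrow> real) set. finite S \<and>
        (\<forall>s\<in>S. range s \<subseteq> \<rat> \<inter> {0..1} \<and> (\<exists>l\<in>{0..1}. s \<longlonglongrightarrow> l)) \<and>
        A \<subseteq> (\<Union>s\<in>S. range s))}"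

text \<open>
  The topology on \<^term>\<open>Pow X\<close> is transported from the product space
  \<open>2\<^sup>X\<close> along the bijection sending a subset of \<open>X\<close> to its characteristic function,
  with \<open>bool\<close> playing the role of \<open>2\<close>. The points of \<^const>\<open>product_topology\<close> are
  extensional functions, hence the \<^const>\<open>restrict\<close>.
\<close>

definition powerset_topology :: "'a set \<Rightarrow> 'a set topology" where
  "powerset_topology X =
     pullback_topology (Pow X) (\<lambda>A. restrict (\<lambda>x. x \<in> A) X)
       (product_topology (\<lambda>_. discrete_topology (UNIV :: bool set)) X)"

text \<open>
  The finite levels (indexed from 1) of the Borel hierarchy of an arbitrary topological space:
  a set is \<open>\<Sigma>\<^sup>0\<^sub>n\<close> for \<open>n > 1\<close> iff it is a countable union of sets each of which
  is \<open>\<Pi>\<^sup>0\<^sub>k\<close> for some \<open>1 \<le> k < n\<close>.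
\<close>

inductive Sigma0 :: "'a topology \<Rightarrow> nat \<Rightarrow> 'a set \<Rightarrow> bool"
  and Pi0 :: "'a topology \<Rightarrow> nat \<Rightarrow> 'a set \<Rightarrow> bool"
  for T :: "'a topology" where
  Sigma0_open: "openin T U \<Longrightarrow> Sigma0 T 1 U"
| Sigma0_Union:
    "(\<And>i :: nat. 1 \<le> k i \<and> k i < n \<and> Pi0 T (k i) (A i)) \<Longrightarrow> Sigma0 T n (\<Union>i. A i)"
| Pi0_compl: "Sigma0 T n A \<Longrightarrow> Pi0 T n (topspace T - A)"

end

theory Submission
  imports Defs "HOL-Library.Sublist"
begin

text \<open>
  The ideal lives on the full binary tree and consists of the sets \<open>L\<close> of nodes with only finitely
  many accumulation points \<open>x \<in> 2\<^sup>\<omega>\<close> whose trace on every branch \<open>x\<close> is small. Smallness on a branch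
  is a copy of \<open>Fin \<otimes> Fin\<close>: a node \<open>s\<close> with \<open>s 0\<^sup>c 1 \<subset> x\<close> has colour \<open>c\<close>, and almost all colours
  must occur only finitely often.

  A P-plus extension \<open>J\<close> contains every branch because of these copies of \<open>Fin \<otimes> Fin\<close>. Descending
  through \<open>J\<close>-positive cones produces a \<open>J\<close>-positive set that converges to some \<open>x\<close>; off the branch
  \<open>x\<close> this set belongs to the ideal, a contradiction.

  Given \<open>f\<close> into the rationals of \<open>[0, 1]\<close>, the colour of a node on the branch is decided after
  \<open>f\<close> has been seen there. So one can play a branch \<open>0\<^sup>c 1 0\<^sup>d 1 \<dots>\<close> along which some limit
  point of \<open>f\<close> is approached within every colour; this gives a positive set on which \<open>f\<close> converges.
\<close>

section \<open>Branches of the binary tree\<close>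

definition pre :: "(nat \<Rightarrow> 'b) \<Rightarrow> nat \<Rightarrow> 'b list" where
  "pre x n = map x [0..<n]"

lemma length_pre [simp]: "length (pre x n) = n"
  by (simp add: pre_def)

lemma nth_pre [simp]: "i < n \<Longrightarrow> pre x n ! i = x i"
  by (simp add: pre_def)

lemma pre_0 [simp]: "pre x 0 = []"
  by (simp add: pre_def)

lemma pre_Suc: "pre x (Suc n) = pre x n @ [x n]"
  by (simp add: pre_def)

lemma inj_pre: "inj (pre x)"
  by (metis injI length_pre)

lemma take_pre: "m \<le> n \<Longrightarrow> take m (pre x n) = pre x m"
  by (simp add: pre_def take_map)

lemma prefix_pre: "m \<le> n \<Longrightarrow> prefix (pre x m) (pre x n)"
  by (metis take_is_prefix take_pre)

lemma pre_eq_iff: "pre x n = pre y n \<longleftrightarrow> (\<forall>i<n. x i = y i)"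
  by (auto simp: pre_def)

lemma prefix_chain_branch:
  assumes "\<And>n. prefix (\<sigma> n) (\<sigma> (Suc n))" and "\<And>n. length (\<sigma> n) < length (\<sigma> (Suc n))"
  obtains x where "\<And>n. pre x (length (\<sigma> n)) = \<sigma> n"
proof -
  have mono: "prefix (\<sigma> m) (\<sigma> n)" if "m \<le> n" for m n
    using that by (induction rule: dec_induct) (use assms(1) prefix_order.trans in blast)+
  have len: "n \<le> length (\<sigma> n)" for n
    by (induction n) (use assms(2) Suc_le_eq le_less_trans in blast)+
  \<comment> \<open>\<open>\<sigma> (Suc i)\<close> is longer than \<open>i\<close>, so its
    \<open>i\<close>-th entry exists; comparable words agree on it.\<close>
  have "pre (\<lambda>i. \<sigma> (Suc i) ! i) (length (\<sigma> n)) = \<sigma> n" for n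
  proof (rule nth_equalityI)
    fix i assume "i < length (pre (\<lambda>i. \<sigma> (Suc i) ! i) (length (\<sigma> n)))"
    then have i: "i < length (\<sigma> n)" by simp
    have i': "i < length (\<sigma> (Suc i))" using len[of "Suc i"] by simp
    have "\<sigma> (Suc i) ! i = \<sigma> n ! i"
      using mono[of "Suc i" n] mono[of n "Suc i"] i i'
      by (metis nle_le prefix_def nth_append)
    then show "pre (\<lambda>i. \<sigma> (Suc i) ! i) (length (\<sigma> n)) ! i = \<sigma> n ! i"
      using i by simp
  qed simp
  then show ?thesis using that by blast
qed

text \<open>Used with two notions of a good cone: one meeting a set infinitely often, and one
  positive for an ideal. Every good node has a good child, so dependent choice builds the
  branch.\<close>

lemma koenig_branch:
  assumes "Q u" and step: "\<And>s. Q s \<Longrightarrow> \<exists>b. Q (s @ [b])"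
  obtains x where "pre x (length u) = u" "\<And>n. length u \<le> n \<Longrightarrow> Q (pre x n)"
proof -
  obtain \<sigma> where \<sigma>: "\<sigma> 0 = u" "\<And>n. Q (\<sigma> n)" "\<And>n. \<exists>b. \<sigma> (Suc n) = \<sigma> n @ [b]"
    using dependent_nat_choice[of "\<lambda>n s. (n = 0 \<longrightarrow> s = u) \<and> Q s" "\<lambda>n s t. \<exists>b. t = s @ [b]"]
      assms by auto metis
  have len: "length (\<sigma> n) = length u + n" for n
  proof (induction n)
    case (Suc n)
    then show ?case using \<sigma>(3)[of n] by auto
  qed (simp add: \<sigma>(1))
  obtain x where x: "\<And>n. pre x (length (\<sigma> n)) = \<sigma> n"
    using prefix_chain_branch[of \<sigma>] \<sigma>(3) len by (metis add_Suc_right lessI prefixI)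
  show ?thesis
  proof
    show "pre x (length u) = u" using x[of 0] \<sigma>(1) by simp
    fix n assume "length u \<le> n"
    then show "Q (pre x n)" using x[of "n - length u"] \<sigma>(2) by (simp add: len)
  qed
qed

section \<open>The ideal\<close>

definition big :: "bool list set \<Rightarrow> bool list \<Rightarrow> bool" where
  "big L u \<longleftrightarrow> infinite {v \<in> L. prefix u v}"

text \<open>The limit points of \<open>L\<close> on the boundary of the compact space of finite and
  infinite binary words.\<close>

definition acc :: "bool list set \<Rightarrow> (nat \<Rightarrow> bool) set" where
  "acc L = {x. \<forall>n. big L (pre x n)}"

text \<open>The nodes on a branch are coloured by the number of zeros of the branch that follow them;
  a branch with finitely many ones has uncoloured nodes.\<close>

definition coloured :: "(nat \<Rightarrow> bool) \<Rightarrow> nat \<Rightarrow> nat set" where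
  "coloured x c = {n. pre x (n + c + 1) = pre x n @ replicate c False @ [True]}"

definition tree_ideal :: "bool list set set" where
  "tree_ideal = {L. finite (acc L) \<and>
     (\<forall>x. \<forall>\<^sub>F c in sequentially. finite {n \<in> coloured x c. pre x n \<in> L})}"

text \<open>The colour of \<open>n\<close> is the distance from \<open>n\<close> to the first
  \<open>True\<close> of \<open>x\<close> at or after that position.\<close>

lemma coloured_unique:
  assumes "n \<in> coloured x c" "n \<in> coloured x d"
  shows "c = d"
proof -
  have *: "x (n + c) \<and> (\<forall>i<c. \<not> x (n + i))" if "n \<in> coloured x c" for c
  proof -
    have "pre x (n + c + 1) ! (n + i) = (replicate c False @ [True]) ! i" for i
      using that by (simp add: coloured_def nth_append)
    then show ?thesis
      by (metis add.assoc add_less_cancel_left less_add_one less_add_same_cancel1 nth_append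
          nth_append_length length_replicate nth_pre nth_replicate trans_less_add1 zero_less_one
          add_strict_mono)
  qed
  show ?thesis
    using *[OF assms(1)] *[OF assms(2)] by (meson linorder_neqE_nat)
qed

section \<open>Accumulation points of sets of nodes\<close>

lemma big_mono: "big K u \<Longrightarrow> K \<subseteq> L \<Longrightarrow> prefix w u \<Longrightarrow> big L w"
  unfolding big_def by (erule contrapos_nn, erule rev_finite_subset) (auto dest: prefix_order.trans)

lemma big_Un: "big (K \<union> L) u \<longleftrightarrow> big K u \<or> big L u"
proof -
  have "{v \<in> K \<union> L. prefix u v} = {v \<in> K. prefix u v} \<union> {v \<in> L. prefix u v}" by auto
  then show ?thesis by (simp add: big_def)
qed

text \<open>Pigeonhole: a cone is its root together with the cones of two children.\<close>

lemma big_extend: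
  assumes "big L u" shows "\<exists>b. big L (u @ [b])"
proof (rule ccontr)
  assume "\<not> ?thesis"
  then have "finite ({u} \<union> {v \<in> L. prefix (u @ [True]) v} \<union> {v \<in> L. prefix (u @ [False]) v})"
    by (simp add: big_def)
  moreover have "{v \<in> L. prefix u v} \<subseteq> \<dots>"
  proof
    fix v assume v: "v \<in> {v \<in> L. prefix u v}"
    then obtain w where "v = u @ w" by (auto simp: prefix_def)
    then show "v \<in> {u} \<union> {v \<in> L. prefix (u @ [True]) v} \<union> {v \<in> L. prefix (u @ [False]) v}"
      using v by (cases w) (auto simp: prefix_def)
  qed
  ultimately show False using assms finite_subset unfolding big_def by blast
qed

lemma finite_short_lists: "finite {v :: bool list. length v < K}"
  using finite_lists_length_le[of "UNIV :: bool set" K] by (rule finite_subset[rotated]) auto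

text \<open>Only finitely many binary words lie below a given length. This trades finiteness for
  number quantifiers, as the complexity computation requires.\<close>

lemma not_big_iff:
  "\<not> big L u \<longleftrightarrow> (\<exists>K. \<forall>v. K \<le> length v \<longrightarrow> prefix u v \<longrightarrow> v \<notin> L)"
proof
  assume "\<not> big L u"
  then have fin: "finite (length ` {v \<in> L. prefix u v})" by (simp add: big_def)
  then obtain K where "\<forall>k \<in> length ` {v \<in> L. prefix u v}. k < K"
    using finite_nat_set_iff_bounded by blast
  then show "\<exists>K. \<forall>v. K \<le> length v \<longrightarrow> prefix u v \<longrightarrow> v \<notin> L"
    by (metis (mono_tags, lifting) image_eqI linorder_not_less mem_Collect_eq)
next
  assume "\<exists>K. \<forall>v. K \<le> length v \<longrightarrow> prefix u v \<longrightarrow> v \<notin> L"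
  then obtain K where "\<forall>v. K \<le> length v \<longrightarrow> prefix u v \<longrightarrow> v \<notin> L" by blast
  then have "{v \<in> L. prefix u v} \<subseteq> {v. length v < K}" by (auto simp: not_le[symmetric])
  then show "\<not> big L u" unfolding big_def using finite_short_lists finite_subset by blast
qed

lemma big_imp_acc:
  assumes "big L u" obtains x where "x \<in> acc L" "pre x (length u) = u"
proof -
  obtain x where x: "pre x (length u) = u" "\<And>n. length u \<le> n \<Longrightarrow> big L (pre x n)"
    using koenig_branch[of "big L" u] assms big_extend by metis
  have "big L (pre x n)" for n
    using x(2)[of "max n (length u)"] big_mono prefix_pre by (metis max.cobounded1 max.cobounded2 order_refl)
  then show ?thesis using that x(1) by (auto simp: acc_def)
qed

lemma acc_mono: "K \<subseteq> L \<Longrightarrow> acc K \<subseteq> acc L"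
  unfolding acc_def by (auto intro: big_mono[OF _ _ prefix_order.refl])

lemma acc_Un: "acc (K \<union> L) = acc K \<union> acc L"
proof
  show "acc (K \<union> L) \<subseteq> acc K \<union> acc L"
  proof
    fix x assume x: "x \<in> acc (K \<union> L)"
    show "x \<in> acc K \<union> acc L"
    proof (rule ccontr)
      assume "x \<notin> acc K \<union> acc L"
      \<comment> \<open>Failure of \<open>big\<close> persists upwards, so both sets fail at the
        larger of the two levels.\<close>
      then obtain m n where "\<not> big K (pre x m)" "\<not> big L (pre x n)" by (auto simp: acc_def)
      then have "\<not> big K (pre x (max m n))" "\<not> big L (pre x (max m n))"
        using big_mono prefix_pre by (metis max.cobounded1 max.cobounded2 order_refl)+
      then show False using x by (auto simp: acc_def big_Un)
    qed
  qed
qed (simp add: acc_mono)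

text \<open>Reduces the colour condition, which ranges over all branches, to the branches in
  \<open>acc L\<close>.\<close>

lemma finite_branch_of_not_acc:
  assumes "x \<notin> acc L" shows "finite {n. pre x n \<in> L}"
proof -
  obtain N where "\<not> big L (pre x N)" using assms by (auto simp: acc_def)
  then have "finite {v \<in> L. prefix (pre x N) v}" by (simp add: big_def)
  then have "finite (pre x -` {v \<in> L. prefix (pre x N) v})"
    using inj_pre by (rule finite_vimageI)
  moreover have "{n. pre x n \<in> L} \<subseteq> {..<N} \<union> pre x -` {v \<in> L. prefix (pre x N) v}"
    using prefix_pre by (auto simp: not_less)
  ultimately show ?thesis by (meson finite_Un finite_lessThan finite_subset)
qed

text \<open>The first assumption says that \<open>L\<close> converges to \<open>x\<close>, so no
  other branch can be an accumulation point and colours matter on \<open>x\<close> only.\<close>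

lemma tree_idealI:
  assumes "\<And>n. finite {v \<in> L. \<not> prefix (pre x n) v}"
    and "\<forall>\<^sub>F c in sequentially. finite {n \<in> coloured x c. pre x n \<in> L}"
  shows "L \<in> tree_ideal"
proof -
  have acc: "y = x" if y: "y \<in> acc L" for y
  proof (rule ccontr)
    assume "y \<noteq> x"
    then obtain n where n: "y n \<noteq> x n" by blast
    have "\<not> prefix (pre x (Suc n)) v" if "prefix (pre y (Suc n)) v" for v
      using that n unfolding prefix_def by (auto simp: pre_Suc)
    then have "{v \<in> L. prefix (pre y (Suc n)) v} \<subseteq> {v \<in> L. \<not> prefix (pre x (Suc n)) v}" by auto
    then show False using y assms(1) finite_subset unfolding acc_def big_def by blast
  qed
  then have "acc L \<subseteq> {x}" by blast
  moreover have "\<forall>\<^sub>F c in sequentially. finite {n \<in> coloured y c. pre y n \<in> L}" for y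
  proof (cases "y = x")
    case False
    then have "finite {n. pre y n \<in> L}" using acc finite_branch_of_not_acc by blast
    then show ?thesis by simp
  qed (simp add: assms(2))
  ultimately show ?thesis unfolding tree_ideal_def using finite_subset by blast
qed

lemma tree_ideal_subset:
  assumes "L \<in> tree_ideal" "K \<subseteq> L" shows "K \<in> tree_ideal"
proof -
  have "\<forall>\<^sub>F c in sequentially. finite {n \<in> coloured x c. pre x n \<in> K}" for x
  proof -
    have "\<forall>\<^sub>F c in sequentially. finite {n \<in> coloured x c. pre x n \<in> L}"
      using assms(1) by (simp add: tree_ideal_def)
    then show ?thesis
      by (rule eventually_mono) (use assms(2) in \<open>auto elim: rev_finite_subset\<close>)
  qed
  moreover have "finite (acc K)"
    using assms(1) acc_mono[OF assms(2)] by (auto simp: tree_ideal_def elim: rev_finite_subset)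
  ultimately show ?thesis by (simp add: tree_ideal_def)
qed

lemma ideal_on_tree_ideal: "ideal_on UNIV tree_ideal"
proof -
  have "K \<union> L \<in> tree_ideal" if "K \<in> tree_ideal" "L \<in> tree_ideal" for K L
  proof -
    have "\<forall>\<^sub>F c in sequentially. finite {n \<in> coloured x c. pre x n \<in> K \<union> L}" for x
    proof -
      have "\<forall>\<^sub>F c in sequentially. finite {n \<in> coloured x c. pre x n \<in> K}"
        "\<forall>\<^sub>F c in sequentially. finite {n \<in> coloured x c. pre x n \<in> L}"
        using that by (simp_all add: tree_ideal_def)
      then show ?thesis
      proof eventually_elim
        case (elim c)
        have "{n \<in> coloured x c. pre x n \<in> K \<union> L} =
          {n \<in> coloured x c. pre x n \<in> K} \<union> {n \<in> coloured x c. pre x n \<in> L}" by auto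
        then show ?case using elim by simp
      qed
    qed
    then show ?thesis using that by (simp add: tree_ideal_def acc_Un)
  qed
  moreover have "L \<in> tree_ideal" if "finite L" for L
    \<comment> \<open>A finite set converges to every branch; the zero branch is an arbitrary
      choice.\<close>
    by (rule tree_idealI[of _ "\<lambda>_. False"])
      (use that in \<open>auto intro!: always_eventually finite_subset[OF _ finite_vimageI[OF that inj_pre]]\<close>)
  moreover have "UNIV \<notin> tree_ideal"
  proof
    assume "UNIV \<in> tree_ideal"
    have "infinite {v. prefix u v}" for u :: "bool list"
    proof
      assume "finite {v. prefix u v}"
      then have "finite (range (\<lambda>n. u @ replicate n True))"
        by (rule rev_finite_subset) auto
      moreover have "inj (\<lambda>n. u @ replicate n True)"
        by (rule injI) (metis append_same_eq same_append_eq length_replicate)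
      ultimately show False using finite_imageD infinite_UNIV_nat by blast
    qed
    then have "acc UNIV = UNIV" by (auto simp: acc_def big_def)
    then have "finite (UNIV :: (nat \<Rightarrow> bool) set)"
      using \<open>UNIV \<in> tree_ideal\<close> by (simp add: tree_ideal_def)
    \<comment> \<open>The characteristic functions of singletons show that there are infinitely many
      branches.\<close>
    moreover have "inj (\<lambda>(n::nat) i. i = n)" by (rule injI) metis
    ultimately show False using finite_imageD finite_subset infinite_UNIV_nat by (metis subset_UNIV)
  qed
  ultimately show ?thesis
    unfolding ideal_on_def by (auto intro: tree_ideal_subset)
qed

section \<open>No extension to a P-plus ideal\<close>

lemma ideal_on_subset: "ideal_on X J \<Longrightarrow> A \<in> J \<Longrightarrow> B \<subseteq> A \<Longrightarrow> B \<in> J"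
  by (simp add: ideal_on_def)

lemma ideal_on_Un: "ideal_on X J \<Longrightarrow> A \<in> J \<Longrightarrow> B \<in> J \<Longrightarrow> A \<union> B \<in> J"
  by (simp add: ideal_on_def)

lemma ideal_on_finite: "ideal_on X J \<Longrightarrow> finite F \<Longrightarrow> F \<subseteq> X \<Longrightarrow> F \<in> J"
  by (simp add: ideal_on_def)

lemma ideal_on_space: "ideal_on X J \<Longrightarrow> X \<notin> J"
  unfolding ideal_on_def by (metis PowD PowI subsetI subset_antisym)

lemma ideal_on_diff:
  assumes "ideal_on X J" "A \<notin> J" "B \<in> J"
  shows "A - B \<notin> J"
proof
  assume "A - B \<in> J"
  then have "(A - B) \<union> B \<in> J" using assms(1,3) by (intro ideal_on_Un)
  moreover have "A \<subseteq> (A - B) \<union> B" by blast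
  ultimately have "A \<in> J" using assms(1) by (metis ideal_on_subset)
  then show False using assms(2) by contradiction
qed

lemma P_plus_idealD:
  assumes "P_plus_ideal UNIV J" "\<And>n. A n \<notin> J" "\<And>n. A (Suc n) \<subseteq> A n"
  obtains B where "B \<notin> J" "\<And>n. finite (B - A n)"
proof -
  have "\<exists>B. B \<subseteq> UNIV \<and> B \<notin> J \<and> (\<forall>n. finite (B - A n))"
    using assms(1)[unfolded P_plus_ideal_def] assms(2,3) by (elim conjE allE[of _ A]) simp
  then show ?thesis using that by auto
qed

text \<open>The argument that \<open>Fin \<otimes> Fin\<close> has no P-plus extension: if the
  branch were positive, removing finitely many colours would keep it positive, yet a
  pseudo-intersection of the remainders has finitely many nodes of each colour.\<close>

lemma branch_in_P_plus:
  assumes P: "P_plus_ideal UNIV J" and sub: "tree_ideal \<subseteq> J"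
  shows "range (pre x) \<in> J"
proof (rule ccontr)
  assume not: "range (pre x) \<notin> J"
  have J: "ideal_on UNIV J" using P by (simp add: P_plus_ideal_def)
  have fin: "finite {v \<in> L. \<not> prefix (pre x n) v}" if L: "L \<subseteq> range (pre x)" for L n
  proof (rule finite_subset)
    show "{v \<in> L. \<not> prefix (pre x n) v} \<subseteq> pre x ` {..<n}"
    proof
      fix v assume v: "v \<in> {v \<in> L. \<not> prefix (pre x n) v}"
      then obtain k where "v = pre x k" using L by blast
      then show "v \<in> pre x ` {..<n}" using v prefix_pre[of n k x] by (cases "n \<le> k") auto
    qed
  qed simp
  define A where "A m = range (pre x) - pre x ` (\<Union>c<m. coloured x c)" for m
  have "A m \<notin> J" for m
  proof -
    have "pre x ` (\<Union>c<m. coloured x c) \<in> tree_ideal"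
    proof (rule tree_idealI)
      \<comment> \<open>Distinct colours are disjoint, so the colours below \<open>m\<close> leave
        no trace on a colour \<open>c\<close> with \<open>m \<le> c\<close>.\<close>
      have "{n \<in> coloured x c. pre x n \<in> pre x ` (\<Union>c<m. coloured x c)} = {}" if "m \<le> c" for c
        using that by (auto dest!: injD[OF inj_pre] dest: coloured_unique)
      then show "\<forall>\<^sub>F c in sequentially.
          finite {n \<in> coloured x c. pre x n \<in> pre x ` (\<Union>c<m. coloured x c)}"
        by (intro eventually_sequentiallyI[of m]) (simp only: finite.emptyI)
    qed (auto intro: fin)
    then have "pre x ` (\<Union>c<m. coloured x c) \<in> J" using sub by (rule subsetD[rotated])
    then show ?thesis unfolding A_def by (rule ideal_on_diff[OF J not])
  qed
  moreover have "A (Suc m) \<subseteq> A m" for m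
    unfolding A_def lessThan_Suc by blast
  ultimately obtain B where B: "B \<notin> J" "\<And>m. finite (B - A m)"
    using P_plus_idealD[OF P, of A] by metis
  have "B \<inter> range (pre x) \<in> tree_ideal"
  proof (rule tree_idealI)
    \<comment> \<open>\<open>A (Suc c)\<close> is the first of the sets to omit colour
      \<open>c\<close>, so these nodes lie in \<open>B - A (Suc c)\<close>.\<close>
    have "finite {n \<in> coloured x c. pre x n \<in> B \<inter> range (pre x)}" for c
      by (rule finite_subset[OF _ finite_vimageI[OF B(2)[of "Suc c"] inj_pre]]) (auto simp: A_def)
    then show "\<forall>\<^sub>F c in sequentially. finite {n \<in> coloured x c. pre x n \<in> B \<inter> range (pre x)}"
      by simp
  qed (auto intro: fin)
  \<comment> \<open>\<open>A 0\<close> is the whole branch.\<close>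
  moreover have "finite (B - range (pre x))"
    using B(2)[of 0] by (rule rev_finite_subset) (auto simp: A_def)
  ultimately have "(B \<inter> range (pre x)) \<union> (B - range (pre x)) \<in> J"
    using sub by (metis (no_types) ideal_on_Un[OF J] ideal_on_finite[OF J] subsetD subset_UNIV)
  then show False using B(1) by (simp add: Int_Diff_Un)
qed

lemma tree_ideal_no_P_plus:
  assumes P: "P_plus_ideal UNIV J" and sub: "tree_ideal \<subseteq> J"
  shows False
proof -
  have J: "ideal_on UNIV J" using P by (simp add: P_plus_ideal_def)
  \<comment> \<open>The pigeonhole of \<open>big_extend\<close>, with positivity for
    \<open>J\<close> in place of infinity.\<close>
  have step: "\<exists>b. {v. prefix (s @ [b]) v} \<notin> J" if "{v. prefix s v} \<notin> J" for s
  proof (rule ccontr)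
    assume "\<not> ?thesis"
    then have "{s} \<union> {v. prefix (s @ [True]) v} \<union> {v. prefix (s @ [False]) v} \<in> J"
      by (intro ideal_on_Un[OF J]) (simp_all add: ideal_on_finite[OF J])
    moreover have "{v. prefix s v} \<subseteq> {s} \<union> {v. prefix (s @ [True]) v} \<union> {v. prefix (s @ [False]) v}"
    proof
      fix v assume "v \<in> {v. prefix s v}"
      then obtain w where "v = s @ w" by (auto simp: prefix_def)
      then show "v \<in> {s} \<union> {v. prefix (s @ [True]) v} \<union> {v. prefix (s @ [False]) v}"
        by (cases w) (auto simp: prefix_def)
    qed
    ultimately show False using that ideal_on_subset[OF J] by metis
  qed
  have "UNIV \<notin> J" using ideal_on_space[OF J] .
  then have "{v. prefix [] v} \<notin> J" by simp
  then obtain x where x: "\<And>n. {v. prefix (pre x n) v} \<notin> J"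
    using koenig_branch[of "\<lambda>s. {v. prefix s v} \<notin> J" "[]"] step by (metis le0 list.size(3))
  moreover have "{v. prefix (pre x (Suc n)) v} \<subseteq> {v. prefix (pre x n) v}" for n
    by (auto simp: pre_Suc intro: append_prefixD)
  ultimately obtain B where B: "B \<notin> J" "\<And>n. finite (B - {v. prefix (pre x n) v})"
    using P_plus_idealD[OF P, of "\<lambda>n. {v. prefix (pre x n) v}"] by metis
  \<comment> \<open>\<open>B\<close> converges to \<open>x\<close>, and without the branch it has
    empty trace on \<open>x\<close>, so the colour condition there is vacuous.\<close>
  have "B - range (pre x) \<in> tree_ideal"
  proof (rule tree_idealI)
    show "finite {v \<in> B - range (pre x). \<not> prefix (pre x n) v}" for n
      using B(2)[of n] by (rule rev_finite_subset) auto
  qed simp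
  moreover have "B - range (pre x) \<notin> J"
    by (rule ideal_on_diff[OF J B(1) branch_in_P_plus[OF P sub]])
  ultimately show False using sub by blast
qed

section \<open>Not above conv in the Katetov order\<close>

text \<open>The pair is the current state and the set of requests already served;
  \<open>P t e\<close> means that request \<open>e\<close> is enabled at state
  \<open>t\<close>.\<close>

primrec greedy_run :: "('s \<Rightarrow> nat \<Rightarrow> bool) \<Rightarrow> ('s \<Rightarrow> nat \<Rightarrow> 's) \<Rightarrow> 's \<Rightarrow> nat \<Rightarrow> 's \<times> nat set" where
  "greedy_run P step s 0 = (s, {})"
| "greedy_run P step s (Suc n) =
     (let (t, W) = greedy_run P step s n; e = (LEAST e. P t e \<and> e \<notin> W)
      in (step t e, insert e W))"

text \<open>No request is served twice, so \<open>q\<close> is injective. A request enabled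
  infinitely often but never served would force infinitely many distinct choices below it.\<close>

lemma greedy_scheduler:
  fixes P :: "'s \<Rightarrow> nat \<Rightarrow> bool"
  assumes "\<And>s. infinite {e. P s e}"
  obtains \<sigma> q where "\<And>n. \<sigma> (Suc n) = step (\<sigma> n) (q n)"
    "\<And>n. P (\<sigma> n) (q n)" "\<And>e. infinite {n. P (\<sigma> n) e} \<Longrightarrow> e \<in> range q"
proof -
  \<comment> \<open>The initial state can be arbitrary because every state enables infinitely many
    requests.\<close>
  define R where "R = greedy_run P step undefined"
  define \<sigma> where "\<sigma> n = fst (R n)" for n
  define W where "W n = snd (R n)" for n
  define q where "q n = (LEAST e. P (\<sigma> n) e \<and> e \<notin> W n)" for n
  have \<sigma>: "\<sigma> (Suc n) = step (\<sigma> n) (q n)" for n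
    by (simp add: \<sigma>_def q_def R_def W_def Let_def split_beta)
  have WS: "W (Suc n) = insert (q n) (W n)" for n
    by (simp add: \<sigma>_def q_def R_def W_def Let_def split_beta)
  have W: "W n = q ` {..<n}" for n
    by (induction n) (simp_all add: WS lessThan_Suc, simp add: W_def R_def)
  have q: "P (\<sigma> n) (q n) \<and> q n \<notin> W n" for n
  proof -
    have "infinite ({e. P (\<sigma> n) e} - W n)" using assms by (simp add: W)
    then obtain e where "P (\<sigma> n) e \<and> e \<notin> W n" by (metis (no_types, lifting) Diff_iff finite.emptyI ex_in_conv mem_Collect_eq)
    then show ?thesis unfolding q_def by (rule LeastI)
  qed
  have inj: "inj q"
    using q unfolding W by (intro linorder_injI) (metis image_eqI lessThan_iff)
  have "e \<in> range q" if "infinite {n. P (\<sigma> n) e}" for e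
  proof (rule ccontr)
    assume e: "e \<notin> range q"
    have "q n \<le> e" if "P (\<sigma> n) e" for n
      unfolding q_def by (rule Least_le) (use that e W in auto)
    then have "q ` {n. P (\<sigma> n) e} \<subseteq> {..e}" by auto
    then have "finite (q ` {n. P (\<sigma> n) e})" using finite_subset by blast
    then show False using that inj finite_imageD inj_on_subset by (metis subset_UNIV)
  qed
  then show ?thesis using that \<sigma> q by blast
qed

lemma strict_mono_choice:
  fixes Q :: "nat \<Rightarrow> nat \<Rightarrow> bool"
  assumes "\<And>m N. \<exists>n\<ge>N. Q m n"
  obtains h where "strict_mono h" "\<And>m. Q m (h m)"
proof -
  have "\<exists>h. \<forall>m. Q m (h m) \<and> h m < h (Suc m)"
  proof (rule dependent_nat_choice)
    show "\<exists>n. Q 0 n" using assms by blast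
    fix n m assume "Q m n"
    show "\<exists>n'. Q (Suc m) n' \<and> n < n'" using assms[of "Suc n" "Suc m"] by (auto simp: Suc_le_eq)
  qed
  then show ?thesis using that by (metis strict_mono_Suc_iff)
qed

text \<open>The branch is played so that the nodes \<open>\<sigma> n\<close> receive their colours one after the other. A
  requirement \<open>(i, k, c, j)\<close> asks, for the \<open>j\<close>-th time, for a node of colour \<open>c\<close> at which
  \<open>f\<close> is within \<open>1 / (k + 1)\<close> of \<open>i / (k + 1)\<close>. Always serving the least
  unserved one makes every limit point of \<open>f \<circ> \<sigma>\<close> a limit point along each colour.\<close>

lemma tree_ideal_not_above_conv:
  fixes f :: "bool list \<Rightarrow> real"
  assumes f: "\<And>s. f s \<in> \<rat> \<inter> {0..1}"
  shows "\<exists>A\<in>conv. f -` A \<notin> tree_ideal"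
proof -
  \<comment> \<open>The inequality is multiplied out by \<open>k + 1\<close>, which avoids
    division.\<close>
  define close where "close s i k \<longleftrightarrow> \<bar>f s * (real k + 1) - real i\<bar> < 1" for s and i k :: nat
  define P where "P s e = (case from_nat e of (i, k, c :: nat, j :: nat) \<Rightarrow> close s i k)" for s e
  define colour where "colour e = (case from_nat e of (i :: nat, k :: nat, c :: nat, j :: nat) \<Rightarrow> c)" for e
  have inf_req: "infinite (range (\<lambda>j :: nat. to_nat (i, k, c, j)))" for i k c :: nat
    by (rule range_inj_infinite) (simp add: inj_on_def)
  have "infinite {e. P s e}" for s
  proof -
    \<comment> \<open>At mesh 1 every value in \<open>{0..1}\<close> is strictly within 1 of an
      endpoint, and \<open>j\<close> gives infinitely many copies of that request.\<close>
    have "close s 0 0 \<or> close s 1 0" using f[of s] by (auto simp: close_def)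
    then obtain i where "close s i 0" by blast
    then have "range (\<lambda>j. to_nat (i, 0 :: nat, 0 :: nat, j :: nat)) \<subseteq> {e. P s e}"
      by (auto simp: P_def)
    then show ?thesis using inf_req finite_subset by blast
  qed
  \<comment> \<open>A request is tested at the current node, and serving it appends the word that
    gives this node its colour.\<close>
  then obtain \<sigma> q where step: "\<And>n. \<sigma> (Suc n) = \<sigma> n @ replicate (colour (q n)) False @ [True]"
    and Pq: "\<And>n. P (\<sigma> n) (q n)" and served: "\<And>e. infinite {n. P (\<sigma> n) e} \<Longrightarrow> e \<in> range q"
    using greedy_scheduler[of P "\<lambda>s e. s @ replicate (colour e) False @ [True]"] by blast
  obtain x where x: "\<And>n. pre x (length (\<sigma> n)) = \<sigma> n"
    using prefix_chain_branch[of \<sigma>] by (simp add: step) blast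
  have coloured: "length (\<sigma> n) \<in> coloured x (colour (q n))" for n
    using x[of n] x[of "Suc n"] by (simp add: coloured_def step)
  obtain l r where l: "l \<in> {0..1}" and r: "strict_mono (r :: nat \<Rightarrow> nat)"
    and lim: "(f \<circ> \<sigma> \<circ> r) \<longlonglongrightarrow> l"
    using compact_Icc[of 0 "1 :: real"] f unfolding compact_def
    by (metis (no_types, lifting) IntD2 comp_apply)
  have limit_in_colour:
    "\<exists>n\<ge>N. colour (q n) = c \<and> \<bar>f (\<sigma> n) - l\<bar> < 2 / (real k + 1)" for N c k
  proof -
    \<comment> \<open>The nearest grid point to \<open>l\<close>: at most half a mesh is lost in
      rounding and less than half in the convergence of \<open>f\<close>, so \<open>close\<close>
      holds eventually along \<open>r\<close>.\<close>
    define i where "i = nat (round (l * (real k + 1)))"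
    have "0 \<le> round (l * (real k + 1))" using l by (simp add: round_def)
    then have i: "\<bar>l * (real k + 1) - real i\<bar> \<le> 1 / 2"
      using of_int_round_abs_le[of "l * (real k + 1)"] by (simp add: i_def abs_minus_commute)
    have "\<forall>\<^sub>F n in sequentially. dist ((f \<circ> \<sigma> \<circ> r) n) l < 1 / (2 * (real k + 1))"
      by (rule tendstoD[OF lim]) simp
    then obtain M where M: "\<And>n. M \<le> n \<Longrightarrow> \<bar>f (\<sigma> (r n)) - l\<bar> < 1 / (2 * (real k + 1))"
      by (auto simp: eventually_sequentially dist_real_def)
    have "close (\<sigma> (r n)) i k" if "M \<le> n" for n
    proof -
      have "\<bar>f (\<sigma> (r n)) - l\<bar> * (real k + 1) < 1 / 2"
        using M[OF that] by (simp add: field_simps)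
      then have "\<bar>f (\<sigma> (r n)) * (real k + 1) - l * (real k + 1)\<bar> < 1 / 2"
        by (simp add: abs_mult flip: left_diff_distrib)
      then show ?thesis using i unfolding close_def by linarith
    qed
    then have "r ` {M..} \<subseteq> {n. P (\<sigma> n) (to_nat (i, k, c, j))}" for j :: nat
      by (auto simp: P_def)
    moreover have "infinite (r ` {M..})"
      using r by (simp add: finite_image_iff strict_mono_imp_inj_on infinite_Ici)
    ultimately have "to_nat (i, k, c, j) \<in> range q" for j :: nat
      using served infinite_super by blast
    then have "range (\<lambda>j :: nat. to_nat (i, k, c, j)) \<subseteq> range q" by (rule image_subsetI)
    \<comment> \<open>Infinitely many distinct codes of this request are served, so one of them is
      served after stage \<open>N\<close>.\<close>
    then have "infinite (q -` range (\<lambda>j :: nat. to_nat (i, k, c, j)))"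
      using inf_req finite_imageI by (metis image_vimage_eq inf.absorb1)
    then obtain n and j :: nat where n: "N \<le> n" "q n = to_nat (i, k, c, j)"
      unfolding infinite_nat_iff_unbounded_le by blast
    then have "close (\<sigma> n) i k" using Pq[of n] by (simp add: P_def)
    then have "\<bar>f (\<sigma> n) * (real k + 1) - l * (real k + 1)\<bar> < 2"
      using i unfolding close_def by linarith
    then have "\<bar>f (\<sigma> n) - l\<bar> * (real k + 1) < 2"
      by (simp add: abs_mult flip: left_diff_distrib)
    then show ?thesis using n by (auto simp: colour_def field_simps)
  qed
  \<comment> \<open>\<open>fst (prod_decode m)\<close> takes every value infinitely often, so one
    sequence visits each colour infinitely often while the bound in \<open>m\<close> makes it
    converge.\<close>
  obtain h where h: "strict_mono h"
    "\<And>m. colour (q (h m)) = fst (prod_decode m) \<and> \<bar>f (\<sigma> (h m)) - l\<bar> < 2 / (real m + 1)"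
    using strict_mono_choice[of "\<lambda>m n. colour (q n) = fst (prod_decode m) \<and> \<bar>f (\<sigma> n) - l\<bar> < 2 / (real m + 1)"]
      limit_in_colour by blast
  define A where "A = range (\<lambda>m. f (\<sigma> (h m)))"
  have "(\<lambda>m. f (\<sigma> (h m)) - l) \<longlonglongrightarrow> 0"
  proof (rule Lim_null_comparison)
    show "\<forall>\<^sub>F m in sequentially. norm (f (\<sigma> (h m)) - l) \<le> 2 / (real m + 1)"
      using h(2) by (auto intro: always_eventually less_imp_le)
    show "(\<lambda>m. 2 / (real m + 1)) \<longlonglongrightarrow> 0"
      using tendsto_mult[OF tendsto_const[of 2] LIMSEQ_inverse_real_of_nat]
      by (simp add: divide_inverse add.commute)
  qed
  then have "(\<lambda>m. f (\<sigma> (h m))) \<longlonglongrightarrow> l" by (simp add: LIM_zero_iff)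
  then have "A \<in> conv"
    unfolding conv_def A_def using f l
    by (auto intro!: exI[of _ "{\<lambda>m. f (\<sigma> (h m))}"])
  moreover have "f -` A \<notin> tree_ideal"
  proof
    assume "f -` A \<in> tree_ideal"
    then have "\<forall>\<^sub>F c in sequentially. finite {n \<in> coloured x c. pre x n \<in> f -` A}"
      by (simp add: tree_ideal_def)
    then obtain c where fin: "finite {n \<in> coloured x c. pre x n \<in> f -` A}"
      by (auto simp: eventually_sequentially)
    \<comment> \<open>The indices \<open>prod_encode (c, j)\<close> pick out infinitely many nodes
      of the single colour \<open>c\<close>.\<close>
    define g where "g j = length (\<sigma> (h (prod_encode (c, j))))" for j
    have "strict_mono (\<lambda>n. length (\<sigma> n))" by (simp add: strict_mono_Suc_iff step)
    then have "length (\<sigma> m) = length (\<sigma> n) \<longleftrightarrow> m = n" for m n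
      by (rule strict_mono_eq)
    then have "inj g"
      using h(1) by (simp add: inj_on_def g_def strict_mono_eq)
    moreover have "range g \<subseteq> {n \<in> coloured x c. pre x n \<in> f -` A}"
    proof (rule image_subsetI)
      fix j
      have "g j \<in> coloured x c"
        using coloured[of "h (prod_encode (c, j))"] h(2)[of "prod_encode (c, j)"] by (simp add: g_def)
      then show "g j \<in> {n \<in> coloured x c. pre x n \<in> f -` A}"
        by (simp add: g_def x A_def)
    qed
    ultimately show False using fin finite_subset range_inj_infinite by blast
  qed
  ultimately show ?thesis by blast
qed

section \<open>Complexity\<close>

lemma finite_separated_branches:
  fixes F :: "(nat \<Rightarrow> 'b) set"
  assumes "finite F" obtains N where "inj_on (\<lambda>x. pre x N) F"
proof -
  have "\<forall>\<^sub>F N in sequentially. pre x N = pre y N \<longrightarrow> x = y" for x y :: "nat \<Rightarrow> 'b"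
  proof (cases "x = y")
    case False
    then obtain i where "x i \<noteq> y i" by blast
    then have "pre x N \<noteq> pre y N" if "Suc i \<le> N" for N
      using that by (auto simp: pre_eq_iff Suc_le_eq)
    then show ?thesis
      unfolding eventually_sequentially by blast
  qed simp
  then have "\<forall>\<^sub>F N in sequentially. \<forall>x\<in>F. \<forall>y\<in>F. pre x N = pre y N \<longrightarrow> x = y"
    by (intro eventually_ball_finite[OF assms] ballI) blast
  then show ?thesis
    using that unfolding eventually_sequentially inj_on_def by blast
qed

text \<open>Finitely many branches separate by some level, and beyond it no node has two big
  children. Conversely, two branches of \<open>acc L\<close> that agree up to \<open>N\<close> would
  first split at a node with two big children.\<close>

lemma finite_acc_iff:
  "finite (acc L) \<longleftrightarrow> (\<exists>N. \<forall>t. N \<le> length t \<longrightarrow> (\<exists>b. \<not> big L (t @ [b])))"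
proof
  assume "finite (acc L)"
  then obtain N where N: "inj_on (\<lambda>x. pre x N) (acc L)" using finite_separated_branches by blast
  have False if t: "N \<le> length t" and b: "\<And>b. big L (t @ [b])" for t
  proof -
    obtain x y where x: "x \<in> acc L" "pre x (Suc (length t)) = t @ [True]"
      and y: "y \<in> acc L" "pre y (Suc (length t)) = t @ [False]"
      using big_imp_acc[OF b] by (metis length_append_singleton)
    then have "pre x (length t) = pre y (length t)" "x (length t) \<noteq> y (length t)"
      by (auto simp: pre_Suc)
    moreover from this have "pre x N = pre y N" using t by (auto simp: pre_eq_iff)
    ultimately show False using N x(1) y(1) by (auto dest: inj_onD)
  qed
  then show "\<exists>N. \<forall>t. N \<le> length t \<longrightarrow> (\<exists>b. \<not> big L (t @ [b]))" by blast
next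
  assume "\<exists>N. \<forall>t. N \<le> length t \<longrightarrow> (\<exists>b. \<not> big L (t @ [b]))"
  then obtain N where N: "\<And>t. N \<le> length t \<Longrightarrow> \<exists>b. \<not> big L (t @ [b])" by blast
  have "inj_on (\<lambda>x. pre x N) (acc L)"
  proof (rule inj_onI, rule ccontr)
    fix x y assume x: "x \<in> acc L" and y: "y \<in> acc L" and eq: "pre x N = pre y N" and "x \<noteq> y"
    then obtain n where n: "x n \<noteq> y n" "\<And>i. i < n \<Longrightarrow> x i = y i"
      using exists_least_iff[of "\<lambda>n. x n \<noteq> y n"] by auto
    then have "N \<le> n" using eq by (metis not_less pre_eq_iff)
    moreover have "pre x n = pre y n" using n(2) by (simp add: pre_eq_iff)
    moreover have "big L (pre x n @ [x n])" "big L (pre y n @ [y n])"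
      using x y by (auto simp: acc_def simp flip: pre_Suc)
    ultimately have "big L (pre x n @ [b])" for b
      using n(1) by (cases b; cases "x n"; cases "y n") auto
    then show False using N[of "pre x n"] \<open>N \<le> n\<close> by simp
  qed
  moreover have "finite ((\<lambda>x. pre x N) ` acc L)"
    by (rule finite_subset[OF _ finite_short_lists[of "Suc N"]]) auto
  ultimately show "finite (acc L)" using finite_imageD by blast
qed

text \<open>Koenig's lemma replaces branches by big nodes: if \<open>s\<close> followed by
  \<open>c\<close> zeros and a one is big, some branch of \<open>acc L\<close> passes through it and
  gives \<open>s\<close> colour \<open>c\<close>.\<close>

lemma tree_ideal_iff_big:
  "L \<in> tree_ideal \<longleftrightarrow>
     (\<exists>N. \<forall>t. N \<le> length t \<longrightarrow> (\<exists>b. \<not> big L (t @ [b]))) \<and>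
     (\<exists>m. \<forall>c\<ge>m. \<exists>M. \<forall>s\<in>L. M \<le> length s \<longrightarrow> \<not> big L (s @ replicate c False @ [True]))"
proof -
  have "(\<forall>x. \<forall>\<^sub>F c in sequentially. finite {n \<in> coloured x c. pre x n \<in> L}) \<longleftrightarrow>
    (\<exists>m. \<forall>c\<ge>m. \<exists>M. \<forall>s\<in>L. M \<le> length s \<longrightarrow> \<not> big L (s @ replicate c False @ [True]))"
    (is "?l \<longleftrightarrow> ?r") if fin: "finite (acc L)"
  proof
    assume ?l
    \<comment> \<open>Finiteness of \<open>acc L\<close> makes the colour threshold uniform over its
      branches.\<close>
    then have "\<forall>\<^sub>F c in sequentially. \<forall>x\<in>acc L. finite {n \<in> coloured x c. pre x n \<in> L}"
      by (intro eventually_ball_finite[OF fin]) blast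
    then obtain m where m: "\<And>c x. m \<le> c \<Longrightarrow> x \<in> acc L \<Longrightarrow> finite {n \<in> coloured x c. pre x n \<in> L}"
      by (auto simp: eventually_sequentially)
    have "\<exists>M. \<forall>s\<in>L. M \<le> length s \<longrightarrow> \<not> big L (s @ replicate c False @ [True])" if "m \<le> c" for c
    proof -
      have "finite (\<Union>x\<in>acc L. {n \<in> coloured x c. pre x n \<in> L})"
        using fin m[OF that] by blast
      then obtain M where M: "\<forall>n\<in>(\<Union>x\<in>acc L. {n \<in> coloured x c. pre x n \<in> L}). n < M"
        using finite_nat_set_iff_bounded by blast
      have "length s < M" if s: "s \<in> L" "big L (s @ replicate c False @ [True])" for s
      proof -
        obtain x where x: "x \<in> acc L" "pre x (length s + c + 1) = s @ replicate c False @ [True]"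
          using big_imp_acc[OF s(2)] by auto
        then have "pre x (length s) = s"
          by (metis append_eq_conv_conj le_add1 take_pre add.assoc)
        then show ?thesis using M x s(1) by (auto simp: coloured_def)
      qed
      then show ?thesis by (meson not_less)
    qed
    then show ?r by blast
  next
    assume ?r
    then obtain m where m: "\<And>c. m \<le> c \<Longrightarrow>
      \<exists>M. \<forall>s\<in>L. M \<le> length s \<longrightarrow> \<not> big L (s @ replicate c False @ [True])" by blast
    have "finite {n \<in> coloured x c. pre x n \<in> L}" if "m \<le> c" for x c
    proof (cases "x \<in> acc L")
      case True
      obtain M where M: "\<And>s. s \<in> L \<Longrightarrow> M \<le> length s \<Longrightarrow> \<not> big L (s @ replicate c False @ [True])"
        using m[OF \<open>m \<le> c\<close>] by blast
      have "n < M" if "n \<in> coloured x c" "pre x n \<in> L" for n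
      proof (rule ccontr)
        assume "\<not> n < M"
        then have "\<not> big L (pre x (n + c + 1))"
          using M[OF that(2)] that(1) by (simp add: coloured_def)
        then show False using True by (simp add: acc_def)
      qed
      then show ?thesis by (intro finite_subset[OF _ finite_lessThan[of M]]) auto
    next
      case False
      then show ?thesis using finite_branch_of_not_acc by auto
    qed
    then show ?l by (auto simp: eventually_sequentially)
  qed
  then show ?thesis unfolding tree_ideal_def finite_acc_iff by auto
qed

text \<open>The matrix of the prenex form. \<open>N\<close> bounds both levels and colours, and
  \<open>K\<close> witnesses both failures of \<open>big\<close>. For fixed parameters it only
  forbids memberships, so it is a closed condition on \<open>L\<close>.\<close>

definition avoids where
  "avoids N c M s t b K L \<longleftrightarrow> (\<forall>v.
     (N \<le> length t \<and> K \<le> length v \<and> prefix (t @ [b]) v \<longrightarrow> v \<notin> L) \<and>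
     (N \<le> c \<and> M \<le> length s \<and> K \<le> length v \<and> prefix (s @ replicate c False @ [True]) v \<longrightarrow>
        s \<notin> L \<or> v \<notin> L))"

text \<open>Pairing \<open>s\<close> with \<open>t\<close> and \<open>b\<close> with
  \<open>K\<close> leaves five alternating quantifiers over a closed matrix; shared bounds are
  merged by maxima.\<close>

lemma tree_ideal_iff_prenex:
  "L \<in> tree_ideal \<longleftrightarrow>
    (\<exists>N. \<forall>c. \<exists>M. \<forall>p. \<exists>r. avoids N c M (fst p) (snd p) (fst r) (snd r) L)"
  (is "_ \<longleftrightarrow> ?r")
proof
  assume "L \<in> tree_ideal"
  then obtain N0 m where N0: "\<And>t. N0 \<le> length t \<Longrightarrow> \<exists>b. \<not> big L (t @ [b])"
    and m: "\<And>c. m \<le> c \<Longrightarrow> \<exists>M. \<forall>s\<in>L. M \<le> length s \<longrightarrow> \<not> big L (s @ replicate c False @ [True])"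
    unfolding tree_ideal_iff_big by blast
  have "\<exists>M. \<forall>s t. \<exists>b K. avoids (max N0 m) c M s t b K L" for c
  proof -
    obtain M where M: "m \<le> c \<Longrightarrow> s \<in> L \<Longrightarrow> M \<le> length s \<Longrightarrow> \<not> big L (s @ replicate c False @ [True])" for s
      using m by blast
    have "\<exists>b K. avoids (max N0 m) c M s t b K L" for s t
    proof -
      obtain b K1 where "N0 \<le> length t \<Longrightarrow> K1 \<le> length v \<Longrightarrow> prefix (t @ [b]) v \<Longrightarrow> v \<notin> L" for v
        using N0[of t] unfolding not_big_iff by blast
      moreover obtain K2 where "m \<le> c \<Longrightarrow> s \<in> L \<Longrightarrow> M \<le> length s \<Longrightarrow> K2 \<le> length v \<Longrightarrow>
          prefix (s @ replicate c False @ [True]) v \<Longrightarrow> v \<notin> L" for v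
        using M[of s] unfolding not_big_iff by blast
      ultimately have "avoids (max N0 m) c M s t b (max K1 K2) L"
        unfolding avoids_def by (meson max.bounded_iff)
      then show ?thesis by blast
    qed
    then show ?thesis by blast
  qed
  then show ?r by (simp add: split_paired_All split_paired_Ex) blast
next
  assume ?r
  then obtain N where N: "\<And>c. \<exists>M. \<forall>s t. \<exists>b K. avoids N c M s t b K L"
    by (auto simp: split_paired_All split_paired_Ex)
  \<comment> \<open>The first clause of \<open>avoids\<close> does not mention \<open>c\<close>, so
    any instance will do.\<close>
  have "\<exists>b. \<not> big L (t @ [b])" if "N \<le> length t" for t
    using N[of 0] that unfolding not_big_iff avoids_def by meson
  moreover have "\<exists>M. \<forall>s\<in>L. M \<le> length s \<longrightarrow> \<not> big L (s @ replicate c False @ [True])" if "N \<le> c" for c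
    using N[of c] that unfolding not_big_iff avoids_def by meson
  ultimately show "L \<in> tree_ideal" unfolding tree_ideal_iff_big by blast
qed

section \<open>Countable quantifiers in the Borel hierarchy\<close>

lemma Sigma0_Collect_ex:
  fixes P :: "'i :: countable \<Rightarrow> 'a \<Rightarrow> bool"
  assumes "1 \<le> n" "\<And>i. Pi0 T n {a. P i a}"
  shows "Sigma0 T (Suc n) {a. \<exists>i. P i a}"
proof -
  have "{a. \<exists>i. P i a} = (\<Union>k. {a. P (from_nat k) a})" by auto (metis from_nat_to_nat)
  moreover have "Sigma0 T (Suc n) \<dots>" by (rule Sigma0_Union[where k = "\<lambda>_. n"]) (use assms in simp)
  ultimately show ?thesis by simp
qed

lemma Pi0_Collect_all:
  fixes P :: "'i :: countable \<Rightarrow> 'a \<Rightarrow> bool"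
  assumes "topspace T = UNIV" "1 \<le> n" "\<And>i. Sigma0 T n {a. P i a}"
  shows "Pi0 T (Suc n) {a. \<forall>i. P i a}"
proof -
  have "Pi0 T n {a. \<not> P i a}" for i
    using Pi0_compl[OF assms(3)[of i]] assms(1) by (simp add: Compl_eq_Diff_UNIV[symmetric] Collect_neg_eq)
  then have "Pi0 T (Suc n) (topspace T - {a. \<exists>i. \<not> P i a})"
    by (intro Pi0_compl Sigma0_Collect_ex assms)
  moreover have "topspace T - {a. \<exists>i. \<not> P i a} = {a. \<forall>i. P i a}" using assms(1) by auto
  ultimately show ?thesis by simp
qed

lemma Pi0_closed:
  assumes "closedin T S" shows "Pi0 T 1 S"
  using Pi0_compl[OF Sigma0_open, of T "topspace T - S"] assms
  by (simp add: closedin_def double_diff)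

lemma topspace_powerset_topology [simp]: "topspace (powerset_topology X) = Pow X"
  by (auto simp: powerset_topology_def topspace_pullback_topology)

lemma openin_powerset_coordinate:
  assumes "v \<in> X"
  shows "openin (powerset_topology X) {A \<in> Pow X. (v \<in> A) = b}"
proof -
  let ?p = "product_topology (\<lambda>_. discrete_topology (UNIV :: bool set)) X"
  have "openin ?p {h \<in> topspace ?p. h v \<in> {b}}"
    using continuous_map_product_projection[OF assms] by (rule openin_continuous_map_preimage) simp
  moreover have "{A \<in> Pow X. (v \<in> A) = b} =
      (\<lambda>A. restrict (\<lambda>x. x \<in> A) X) -` {h \<in> topspace ?p. h v \<in> {b}} \<inter> Pow X"
    using assms by auto
  ultimately show ?thesis
    unfolding powerset_topology_def openin_pullback_topology by blast
qed

lemma closedin_powerset_UNIV_not_mem: "closedin (powerset_topology UNIV) {A. v \<notin> A}"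
  using openin_powerset_coordinate[of v UNIV True]
  by (simp add: closedin_def Compl_eq_Diff_UNIV[symmetric] Collect_neg_eq)

lemma closedin_Collect_all:
  assumes "\<And>i. closedin T {a. P i a}" shows "closedin T {a. \<forall>i. P i a}"
  using closedin_INT[of UNIV T "\<lambda>i. {a. P i a}"] assms by (simp add: Collect_all_eq)

lemma Sigma0_tree_ideal:
  fixes enc :: "bool list \<Rightarrow> 'a"
  shows "Sigma0 (powerset_topology UNIV) 6 {A. enc -` A \<in> tree_ideal}"
proof -
  let ?T = "powerset_topology (UNIV :: 'a set)"
  have top: "topspace ?T = UNIV" by simp
  have imp: "closedin ?T {A. p \<longrightarrow> Q A}" if "closedin ?T {A. Q A}" for p Q
    using that closedin_topspace[of ?T] by (cases p) simp_all
  have disj: "closedin ?T {A. Q A \<or> R A}" if "closedin ?T {A. Q A}" "closedin ?T {A. R A}" for Q R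
    using closedin_Un[OF that] by (simp add: Collect_disj_eq)
  have conj: "closedin ?T {A. Q A \<and> R A}" if "closedin ?T {A. Q A}" "closedin ?T {A. R A}" for Q R
    using closedin_Int[OF that] by (simp add: Collect_conj_eq)
  have "closedin ?T {A. avoids N c M s t b K (enc -` A)}" for N c M s t b K
    unfolding avoids_def vimage_eq
    by (intro closedin_Collect_all conj imp disj closedin_powerset_UNIV_not_mem)
  from Pi0_closed[OF this]
  \<comment> \<open>The closed matrix is at level 1, and each of the five quantifiers adds one
    level.\<close>
  have "Sigma0 ?T (Suc (Suc (Suc (Suc (Suc 1))))) {A. enc -` A \<in> tree_ideal}"
    unfolding tree_ideal_iff_prenex
    by (intro Sigma0_Collect_ex Pi0_Collect_all top) (simp_all del: One_nat_def)
  then show ?thesis by (simp add: eval_nat_numeral)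
qed

section \<open>Transport to the natural numbers\<close>

text \<open>Opposite in direction to \<open>ideal_on_vimage\<close>: a hypothetical extension on the
  numbers is pulled back to the tree, where \<open>tree_ideal_no_P_plus\<close> refutes it.\<close>

lemma P_plus_ideal_vimage:
  assumes "bij h" and P: "P_plus_ideal UNIV J"
  shows "P_plus_ideal UNIV {L. h ` L \<in> J}"
proof -
  have h: "inj h" "\<And>B. h ` (h -` B) = B" using assms(1) by (auto simp: bij_def surj_image_vimage_eq)
  have J: "ideal_on UNIV J" using P by (simp add: P_plus_ideal_def)
  have "\<exists>B. h ` B \<notin> J \<and> (\<forall>n. finite (B - A n))"
    if A: "\<And>n. h ` A n \<notin> J \<and> A (Suc n) \<subseteq> A n" for A :: "nat \<Rightarrow> 'a set"
  proof -
    obtain B where B: "B \<notin> J" "\<And>n. finite (B - h ` A n)"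
      using P_plus_idealD[OF P, of "\<lambda>n. h ` A n"] A image_mono by metis
    have "finite (h -` B - A n)" for n
      by (rule finite_subset[OF _ finite_vimageI[OF B(2) h(1)]]) (use h(1) in \<open>auto dest: injD\<close>)
    then show ?thesis using B(1) h(2) by metis
  qed
  moreover have "ideal_on UNIV {L. h ` L \<in> J}"
    unfolding ideal_on_def
  proof (intro conjI ballI allI impI)
    have "UNIV \<notin> {L. h ` L \<in> J}" using ideal_on_space[OF J] assms(1) by (simp add: bij_def)
    then show "{L. h ` L \<in> J} \<noteq> Pow UNIV" by blast
    show "B \<in> {L. h ` L \<in> J}" if "A \<in> {L. h ` L \<in> J}" "B \<subseteq> A" for A B
      using that ideal_on_subset[OF J] image_mono by (metis mem_Collect_eq)
  qed (simp_all add: image_Un ideal_on_Un[OF J] ideal_on_finite[OF J])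
  ultimately show ?thesis unfolding P_plus_ideal_def by simp
qed

lemma ideal_on_vimage:
  assumes "bij h" "ideal_on UNIV I"
  shows "ideal_on UNIV {A. h -` A \<in> I}"
  unfolding ideal_on_def
proof (intro conjI ballI allI impI)
  have "UNIV \<notin> {A. h -` A \<in> I}" using ideal_on_space[OF assms(2)] by simp
  then show "{A. h -` A \<in> I} \<noteq> Pow UNIV" by blast
  show "F \<in> {A. h -` A \<in> I}" if "F \<subseteq> UNIV \<and> finite F" for F
    using that assms(1) by (simp add: ideal_on_finite[OF assms(2)] bij_def finite_vimageI)
  show "B \<in> {A. h -` A \<in> I}" if "A \<in> {A. h -` A \<in> I}" "B \<subseteq> A" for A B
    using that ideal_on_subset[OF assms(2)] vimage_mono by (metis mem_Collect_eq)
qed (simp_all add: ideal_on_Un[OF assms(2)])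

theorem theorem3p4:
  "\<exists>(X :: nat set) (I :: nat set set).
     infinite X \<and> countable X \<and> ideal_on X I \<and>
     Sigma0 (powerset_topology X) 6 I \<and>
     \<not> (\<exists>J. P_plus_ideal X J \<and> I \<subseteq> J) \<and>
     \<not> conv \<le>\<^sub>K I"
proof -
  define enc where "enc = to_nat_on (UNIV :: bool list set)"
  have bij: "bij enc"
    unfolding enc_def by (rule to_nat_on_infinite) (auto simp: infinite_UNIV_listI)
  define I where "I = {A. enc -` A \<in> tree_ideal}"
  have ideal: "ideal_on UNIV I"
    unfolding I_def using bij ideal_on_tree_ideal by (rule ideal_on_vimage)
  have "\<not> (P_plus_ideal UNIV J \<and> I \<subseteq> J)" for J
  proof
    assume J: "P_plus_ideal UNIV J \<and> I \<subseteq> J"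
    have "tree_ideal \<subseteq> {L. enc ` L \<in> J}"
      using J bij by (auto simp: I_def bij_def inj_vimage_image_eq)
    then show False using tree_ideal_no_P_plus P_plus_ideal_vimage[OF bij] J by blast
  qed
  moreover have "\<not> conv \<le>\<^sub>K I"
  proof
    assume "conv \<le>\<^sub>K I"
    \<comment> \<open>The Katetov map is defined on \<open>\<Union>I\<close>; this makes it
      total.\<close>
    moreover have "\<Union>I = UNIV"
    proof -
      have "{n} \<in> I" for n by (rule ideal_on_finite[OF ideal]) simp_all
      then show ?thesis by blast
    qed
    ultimately obtain f where f: "\<And>n. f n \<in> \<Union>conv" "\<And>A. A \<in> conv \<Longrightarrow> f -` A \<in> I"
      unfolding katetov_le_def by (simp add: Pi_iff) blast
    have "(f \<circ> enc) s \<in> \<rat> \<inter> {0..1}" for s using f(1)[of "enc s"] by (auto simp: conv_def)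
    then obtain A where "A \<in> conv" "(f \<circ> enc) -` A \<notin> tree_ideal"
      using tree_ideal_not_above_conv by blast
    then show False using f(2) by (simp add: I_def vimage_comp)
  qed
  ultimately show ?thesis
    using ideal Sigma0_tree_ideal[of enc] by (intro exI[of _ UNIV] exI[of _ I]) (auto simp: I_def)
qed

end
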